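(* Let $G$ be a digraph with $n$ vertices and minimum outdegree $\delta>72\log(3n)$. Then $G$ has a majority $3$-colouring. Moreover, the $3$-colouring can be chosen so that, for every vertex $v$ of $G$ and every colour $c\in\{1,2,3\}$, at most half the out-neighbours of $v$ receive colour $c$.
   Context: Digraphs are finite, with no loops and no parallel arcs (a pair of oppositely directed arcs $uv$ and $vu$ is allowed). $\log$ denotes the natural logarithm. A majority $3$-colouring of a digraph is a function assigning each vertex one of three colours such that, for each vertex $v$, at most half the out-neighbours of $v$ receive the same colour as $v$. *)

theory Defs
  imports Complex_Main "Graph_Theory.Digraph"
begin

definition out_neighbours :: "('a, 'b) pre_digraph \<Rightarrow> 'a \<Rightarrow> 'a set" where
  "out_neighbours G v = {w. v \<rightarrow>\<^bsub>G\<^esub> w}"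

text \<open>Only meaningful for a digraph with finite, nonempty vertex set.\<close>

definition min_out_degree :: "('a, 'b) pre_digraph \<Rightarrow> nat" where
  "min_out_degree G = Min (out_degree G ` verts G)"

text \<open>The three colours are the natural numbers 1, 2, 3; values of the function outside
  the vertex set are irrelevant.\<close>

definition three_colouring :: "('a, 'b) pre_digraph \<Rightarrow> ('a \<Rightarrow> nat) \<Rightarrow> bool" where
  "three_colouring G f \<longleftrightarrow> (\<forall>v \<in> verts G. f v \<in> {1, 2, 3})"

definition majority_3_colouring :: "('a, 'b) pre_digraph \<Rightarrow> ('a \<Rightarrow> nat) \<Rightarrow> bool" where
  "majority_3_colouring G f \<longleftrightarrow> three_colouring G f \<and>
     (\<forall>v \<in> verts G.
        real (card {w \<in> out_neighbours G v. f w = f v}) \<le> real (card (out_neighbours G v)) / 2)"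

end

theory Submission
  imports Defs "HOL-Library.FuncSet"
begin

text \<open>Colour the vertices uniformly at random. If more than half of the \<open>d\<close> out-neighbours of
  \<open>v\<close> receive colour \<open>c\<close>, then the number \<open>X\<close> of these satisfies \<open>2 ^ X / sqrt 2 ^ d > 1\<close>.
  The mean of this exponential weight is \<open>(4 / (3 * sqrt 2)) ^ d \<le> exp (- d / 18)\<close>, so for large
  outdegrees the total mean over all pairs \<open>(v, c)\<close> is below \<open>1\<close>, and some colouring has no such
  pair. The mean is computed as a sum over all colourings.\<close>

lemma sum_power_colour_class:
  fixes N V :: "'a set" and K :: "'c set" and z :: "'b::comm_semiring_1"
  assumes "finite V" "N \<subseteq> V" "finite K" "c \<in> K"
  shows "(\<Sum>f\<in>V \<rightarrow>\<^sub>E K. z ^ card {w \<in> N. f w = c})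
         = (z + of_nat (card K - 1)) ^ card N * of_nat (card K) ^ (card V - card N)"
proof -
  have "(\<Sum>f\<in>V \<rightarrow>\<^sub>E K. z ^ card {w \<in> N. f w = c})
        = (\<Sum>f\<in>V \<rightarrow>\<^sub>E K. \<Prod>w\<in>V. if w \<in> N \<and> f w = c then z else 1)"
  proof (rule sum.cong[OF refl])
    fix f
    have "{w \<in> V. w \<in> N \<and> f w = c} = {w \<in> N. f w = c}"
      using assms(2) by auto
    then show "z ^ card {w \<in> N. f w = c} = (\<Prod>w\<in>V. if w \<in> N \<and> f w = c then z else 1)"
      using assms(1) by (simp add: prod.If_cases Int_def)
  qed
  \<comment> \<open>Colours of distinct vertices are independent, so the sum over all colourings
    factors. A vertex of \<open>N\<close> contributes \<open>z\<close> for colour \<open>c\<close>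
    and 1 for each other colour.\<close>
  also have "\<dots> = (\<Prod>w\<in>V. \<Sum>a\<in>K. if w \<in> N \<and> a = c then z else 1)"
    by (rule prod_sum_PiE[symmetric]) (use assms in auto)
  also have "\<dots> = (\<Prod>w\<in>V. if w \<in> N then z + of_nat (card K - 1) else of_nat (card K))"
  proof (rule prod.cong[OF refl])
    fix w
    have "of_nat (card K) = (1 + of_nat (card K - 1) :: 'b)"
      using card_Suc_Diff1[OF assms(3,4)] assms(4) by (metis card_Diff_singleton of_nat_Suc)
    then show "(\<Sum>a\<in>K. if w \<in> N \<and> a = c then z else 1)
               = (if w \<in> N then z + of_nat (card K - 1) else of_nat (card K))"
      using assms(3,4) by (simp add: sum.remove[of K c])
  qed
  also have "\<dots> = (z + of_nat (card K - 1)) ^ card N * of_nat (card K) ^ (card V - card N)"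
  proof -
    have "{w \<in> V. w \<in> N} = N" "V \<inter> - N = V - N"
      using assms(2) by auto
    then show ?thesis
      using assms by (simp add: prod.If_cases Int_absorb1 card_Diff_subset finite_subset)
  qed
  finally show ?thesis .
qed

text \<open>The left side is the mean weight factor of one vertex, \<open>(2 + 1 + 1) / 3\<close>
  divided by \<open>sqrt 2\<close>. Its square is 8/9 = 1 - 1/9, so \<open>1 + x \<le> exp x\<close>
  applies, and taking the root halves the exponent 1/9 to 1/18.\<close>

lemma exponential_mean_le: "4 / (3 * sqrt 2) \<le> exp (- 1 / 18 :: real)"
proof (rule power2_le_imp_le)
  have "(4 / (3 * sqrt 2))\<^sup>2 = 1 + (- 1 / 9 :: real)"
    by (simp add: power_divide power_mult_distrib)
  also have "\<dots> \<le> exp (- 1 / 9)"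
    by (rule exp_ge_add_one_self)
  also have "\<dots> = (exp (- 1 / 18))\<^sup>2"
    by (simp add: power2_eq_square flip: exp_add)
  finally show "(4 / (3 * sqrt 2))\<^sup>2 \<le> (exp (- 1 / 18 :: real))\<^sup>2" .
qed simp

text \<open>There are \<open>3 ^ card V\<close> colourings, so this bounds the mean weight by
  \<open>exp (- card N / 18)\<close>. The divisor \<open>sqrt 2 ^ card N\<close> is the value of
  \<open>2 ^ X\<close> at the threshold \<open>X = card N / 2\<close>.\<close>

lemma sum_colour_weight_le:
  fixes N V :: "'a set" and K :: "'c set"
  assumes "finite V" "N \<subseteq> V" "finite K" "card K = 3" "c \<in> K"
  shows "(\<Sum>f\<in>V \<rightarrow>\<^sub>E K. 2 ^ card {w \<in> N. f w = c} / sqrt 2 ^ card N)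
         \<le> 3 ^ card V * exp (- real (card N) / 18)"
proof -
  have le: "card N \<le> card V"
    using assms by (simp add: card_mono)
  have "(\<Sum>f\<in>V \<rightarrow>\<^sub>E K. 2 ^ card {w \<in> N. f w = c} / sqrt 2 ^ card N)
        = 4 ^ card N * 3 ^ (card V - card N) / sqrt 2 ^ card N"
    using sum_power_colour_class[OF assms(1-3,5), of "2::real"] assms(4)
    by (simp flip: sum_divide_distrib)
  also have "\<dots> = 3 ^ card V * (4 / (3 * sqrt 2)) ^ card N"
    using le by (simp add: power_divide power_mult_distrib power_diff)
  also have "\<dots> \<le> 3 ^ card V * exp (- 1 / 18) ^ card N"
    by (intro mult_left_mono power_mono exponential_mean_le) auto
  also have "exp (- 1 / 18 :: real) ^ card N = exp (- real (card N) / 18)"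
    by (simp flip: exp_of_nat_mult)
  finally show ?thesis .
qed

text \<open>First-moment argument for an arbitrary family of sets. The factor 3 in
  \<open>small\<close> is a union bound over the colours.\<close>

lemma ex_colouring_all_sets_balanced:
  fixes V :: "'a set" and N :: "'i \<Rightarrow> 'a set" and K :: "'c set"
  assumes "finite V" "finite I" "card K = 3"
    and N: "\<And>i. i \<in> I \<Longrightarrow> N i \<subseteq> V"
    and small: "3 * (\<Sum>i\<in>I. exp (- real (card (N i)) / 18)) < 1"
  obtains f where "f \<in> V \<rightarrow>\<^sub>E K"
    and "\<And>i c. i \<in> I \<Longrightarrow> c \<in> K \<Longrightarrow> real (card {w \<in> N i. f w = c}) \<le> real (card (N i)) / 2"
proof -
  have "finite K"
    using assms(3) by (simp add: card_ge_0_finite)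
  define W where "W i c f = 2 ^ card {w \<in> N i. f w = c} / sqrt 2 ^ card (N i)" for i and c :: 'c and f
  have W_nonneg: "W i c f \<ge> 0" for i c f
    by (simp add: W_def)
  have "(\<Sum>f\<in>V \<rightarrow>\<^sub>E K. \<Sum>i\<in>I. \<Sum>c\<in>K. W i c f) = (\<Sum>i\<in>I. \<Sum>c\<in>K. \<Sum>f\<in>V \<rightarrow>\<^sub>E K. W i c f)"
    by (subst sum.swap, intro sum.cong[OF refl] sum.swap)
  also have "\<dots> \<le> (\<Sum>i\<in>I. \<Sum>c\<in>K. 3 ^ card V * exp (- real (card (N i)) / 18))"
    unfolding W_def by (intro sum_mono sum_colour_weight_le assms \<open>finite K\<close>)
  also have "\<dots> = 3 ^ card V * (3 * (\<Sum>i\<in>I. exp (- real (card (N i)) / 18)))"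
    using assms(3) by (simp add: sum_distrib_left mult_ac)
  also have "\<dots> < 3 ^ card V"
    using small by simp
  also have "\<dots> = (\<Sum>f\<in>V \<rightarrow>\<^sub>E K. 1)"
    using assms by (simp add: card_PiE)
  \<comment> \<open>If every colouring had total weight at least 1, the sum would be at least the
    number of colourings.\<close>
  finally obtain f where f: "f \<in> V \<rightarrow>\<^sub>E K" and less: "(\<Sum>i\<in>I. \<Sum>c\<in>K. W i c f) < 1"
    by (meson sum_mono not_le)
  have "real (card {w \<in> N i. f w = c}) \<le> real (card (N i)) / 2" if "i \<in> I" "c \<in> K" for i c
  proof -
    have "W i c f \<le> (\<Sum>c\<in>K. W i c f)"
      using that \<open>finite K\<close> W_nonneg by (intro member_le_sum) auto
    also have "\<dots> \<le> (\<Sum>i\<in>I. \<Sum>c\<in>K. W i c f)"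
      using that assms(2) W_nonneg
      by (intro member_le_sum[where f = "\<lambda>i. \<Sum>c\<in>K. W i c f"] sum_nonneg) auto
    finally have "W i c f < 1"
      using less by linarith
    \<comment> \<open>Both sides become powers of \<open>sqrt 2 > 1\<close>, so the exponents can be
      compared.\<close>
    moreover have "(2::real) ^ card {w \<in> N i. f w = c} = sqrt 2 ^ (2 * card {w \<in> N i. f w = c})"
      by (simp add: power_mult)
    ultimately have "sqrt 2 ^ (2 * card {w \<in> N i. f w = c}) < sqrt 2 ^ card (N i)"
      by (simp add: W_def)
    then have "2 * card {w \<in> N i. f w = c} < card (N i)"
      by (rule power_less_imp_less_exp[rotated]) simp
    then show ?thesis
      by linarith
  qed
  with f show thesis
    by (rule that)
qed

lemma (in wf_digraph) out_neighbours_subset: "out_neighbours G v \<subseteq> verts G"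
  by (auto simp: out_neighbours_def arcs_ends_def arc_to_ends_def)

text \<open>\<open>out_degree\<close> counts arcs; without parallel arcs, \<open>head\<close> is
  injective on the arcs leaving \<open>v\<close>.\<close>

lemma (in nomulti_digraph) card_out_neighbours: "card (out_neighbours G v) = out_degree G v"
proof -
  have "out_neighbours G v = head G ` out_arcs G v"
    by (auto simp: out_neighbours_def arcs_ends_def arc_to_ends_def)
  moreover have "inj_on (head G) (out_arcs G v)"
    by (auto intro!: inj_onI no_multi_arcs simp: arc_to_ends_def)
  ultimately show ?thesis
    by (simp add: card_image out_degree_def)
qed

lemma (in fin_digraph) min_out_degree_le: "v \<in> verts G \<Longrightarrow> min_out_degree G \<le> out_degree G v"
  by (simp add: min_out_degree_def)

theorem theorem3:
  fixes G :: "('a, 'b) pre_digraph" and n \<delta> :: nat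
  assumes "digraph G"
    and "card (verts G) = n"
    and "min_out_degree G = \<delta>"
    and "real \<delta> > 72 * ln (3 * real n)"
  shows "(\<exists>f. majority_3_colouring G f) \<and>
         (\<exists>f. majority_3_colouring G f \<and>
           (\<forall>v \<in> verts G. \<forall>c \<in> {1, 2, 3}.
              real (card {w \<in> out_neighbours G v. f w = c})
                \<le> real (card (out_neighbours G v)) / 2))"
proof -
  interpret digraph G by fact
  have small: "3 * (\<Sum>v\<in>verts G. exp (- real (card (out_neighbours G v)) / 18)) < 1"
  proof (cases "n = 0")
    case True
    then show ?thesis
      using assms(2) by simp
  next
    case False
    \<comment> \<open>Nonnegativity gives \<open>72 * ln (3 * n) \<ge> 18 * ln (3 * n)\<close>,
      which matches the rate 1/18 of the mean bound.\<close>
    have "ln (3 * real n) \<ge> 0"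
      using False by simp
    then have "ln (3 * real n) < real \<delta> / 18"
      using assms(4) by simp
    then have "exp (ln (3 * real n)) < exp (real \<delta> / 18)"
      by simp
    then have n: "3 * real n < exp (real \<delta> / 18)"
      using False by simp
    have "(\<Sum>v\<in>verts G. exp (- real (card (out_neighbours G v)) / 18))
          \<le> (\<Sum>v\<in>verts G. exp (- real \<delta> / 18))"
      using min_out_degree_le assms(3) by (intro sum_mono) (simp add: card_out_neighbours)
    also have "\<dots> = real n / exp (real \<delta> / 18)"
      using assms(2) by (simp add: exp_minus field_simps)
    finally have "3 * (\<Sum>v\<in>verts G. exp (- real (card (out_neighbours G v)) / 18))
                  \<le> 3 * real n / exp (real \<delta> / 18)"
      by simp
    also have "\<dots> < 1"
      using n by simp
    finally show ?thesis .
  qed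
  have three: "card {1, 2, 3::nat} = 3"
    by simp
  obtain f where f: "f \<in> verts G \<rightarrow>\<^sub>E {1, 2, 3::nat}"
    and bal: "\<And>v c. v \<in> verts G \<Longrightarrow> c \<in> {1, 2, 3} \<Longrightarrow>
      real (card {w \<in> out_neighbours G v. f w = c}) \<le> real (card (out_neighbours G v)) / 2"
    by (rule ex_colouring_all_sets_balanced
          [OF finite_verts finite_verts three out_neighbours_subset small]) blast
  have col: "f v \<in> {1, 2, 3}" if "v \<in> verts G" for v
    using f that by (rule PiE_mem)
  \<comment> \<open>The majority condition at \<open>v\<close> is the balance bound for the colour
    \<open>c = f v\<close>.\<close>
  then have "majority_3_colouring G f"
    unfolding majority_3_colouring_def three_colouring_def using bal by blast
  then show ?thesis
    using bal by blast
qed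

end
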